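(* Let $G$ be a nontrivial ordered additive abelian group. For all integers $k\ge 2$, \[ \widehat{\mathcal{R}}_{\mathbb{Z}}(2,k) = \widehat{\mathcal{R}}_G(2,k) = \left[2k-3, \frac{k^2-k}{2}\right]. \] Moreover, for every $t\in \widehat{\mathcal{R}}_{\mathbb{Z}}(2,k)$ there exists a set $A\subseteq [0,2^{k-2}]$ of integers with $|A|=k$ and $|\widehat{2A}|=t$.
   Context: An additive abelian group $G$ is ordered with respect to a total order $<$ if $x<y$ implies $x+z<y+z$ for all $x,y,z\in G$. For real $u,v$, $[u,v]=\{c\in\mathbb{Z}: u\le c\le v\}$. For a subset $A$ of $G$, $\widehat{2A}=\{a+b : a,b\in A,\ a\ne b\}$ is the 2-fold restricted sumset. $\widehat{\mathcal{R}}_G(2,k)=\{|\widehat{2A}| : A\subseteq G,\ |A|=k\}$, and $\widehat{\mathcal{R}}_{\mathbb{Z}}(2,k)$ is this set for $G=\mathbb{Z}$. *)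

theory Defs
  imports Complex_Main
begin

definition int_interval :: "real \<Rightarrow> real \<Rightarrow> int set" where
  "int_interval u v = {c :: int. u \<le> real_of_int c \<and> real_of_int c \<le> v}"

definition restricted_sumset :: "'a::ab_group_add set \<Rightarrow> 'a set" where
  "restricted_sumset A = {a + b | a b. a \<in> A \<and> b \<in> A \<and> a \<noteq> b}"

text \<open>
  The ambient group is passed as a set, so that \<open>UNIV :: 'a set\<close> stands for the group \<open>'a\<close>.
  Sizes are recorded as integers for comparison with \<^const>\<open>int_interval\<close>; the explicit
  finiteness matters because \<^const>\<open>card\<close> is 0 on infinite sets.
\<close>

definition restricted_sumset_sizes :: "'a::ab_group_add set \<Rightarrow> nat \<Rightarrow> int set" where
  "restricted_sumset_sizes G k =
     {int (card (restricted_sumset A)) | A. A \<subseteq> G \<and> finite A \<and> card A = k}"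

end

theory Submission
  imports Defs
begin

text \<open>
  Write \<open>A = insert x B\<close>, so that the restricted sumset of \<open>A\<close> is that of \<open>B\<close> together with the
  translate \<open>x + B\<close>. If \<open>x\<close> is the maximum of \<open>A\<close>, then \<open>x\<close> plus either of the two largest elements
  of \<open>B\<close> exceeds every old sum; so each insertion contributes at least 2 and at most \<open>card B\<close> new
  sums, and the bounds follow by induction.

  Conversely, adding \<open>2 ^ (k - 1)\<close> to a \<open>k\<close>-set inside \<open>[0, 2 ^ (k - 2)]\<close> creates exactly \<open>k\<close> new sums,
  which realises all sizes from \<open>3 k - 3\<close> on for \<open>k + 1\<close> elements. The smaller sizes come from
  an interval plus one further point, \<open>{0..k - 1} \<union> {x}\<close> with \<open>k \<le> x \<le> 2 k - 2\<close>. Multiples of a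
  positive element carry these integer examples over to any nontrivial ordered group.
\<close>

lemma restricted_sumset_singleton [simp]: "restricted_sumset {x} = {}"
  by (auto simp: restricted_sumset_def)

lemma restricted_sumset_insert:
  assumes "x \<notin> B"
  shows "restricted_sumset (insert x B) = restricted_sumset B \<union> (+) x ` B"
  using assms unfolding restricted_sumset_def
  by (auto simp: add.commute)

lemma finite_restricted_sumset:
  assumes "finite A"
  shows "finite (restricted_sumset A)"
proof (rule finite_subset)
  show "restricted_sumset A \<subseteq> (\<lambda>(a, b). a + b) ` (A \<times> A)"
    by (auto simp: restricted_sumset_def)
qed (use assms in simp)

text \<open>Clearing the denominator and moving \<open>card A\<close> to the left keeps the bound k
  (k - 1) / 2 inside the naturals, free of truncated subtraction.\<close>

lemma card_restricted_sumset_le: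
  assumes "finite A"
  shows "2 * card (restricted_sumset A) + card A \<le> card A ^ 2"
  using assms
proof (induction A)
  case empty
  show ?case by (simp add: restricted_sumset_def)
next
  case (insert x B)
  have "card (restricted_sumset (insert x B)) \<le> card (restricted_sumset B) + card ((+) x ` B)"
    unfolding restricted_sumset_insert[OF insert(2)] by (rule card_Un_le)
  also have "\<dots> = card (restricted_sumset B) + card B"
    by (simp add: card_image)
  finally show ?case
    using insert by (simp add: power2_eq_square)
qed

lemma card_restricted_sumset_ge:
  fixes A :: "'a::linordered_ab_group_add set"
  assumes "finite A" "card A \<ge> 2"
  shows "2 * card A \<le> card (restricted_sumset A) + 3"
  using assms
proof (induction A rule: finite_linorder_max_induct)
  case empty
  then show ?case by simp
next
  case (insert x B)
  have x: "x \<notin> B" using insert by auto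
  show ?case
  proof (cases "card B \<ge> 2")
    \<comment> \<open>The induction hypothesis needs two elements in \<open>B\<close>, so the
      induction really starts here, at a two-element set with its single sum.\<close>
    case False
    then have "card B = 1" using insert x by simp
    then obtain b where "B = {b}" by (rule card_1_singletonE)
    then have "restricted_sumset (insert x B) = {x + b}"
      using restricted_sumset_insert[OF x] by simp
    then show ?thesis using \<open>card B = 1\<close> insert x by simp
  next
    case True
    define m where "m = Max B"
    define m' where "m' = Max (B - {m})"
    have B: "B \<noteq> {}" using True by auto
    then have m: "m \<in> B" using insert by (auto simp: m_def)
    have "card (B - {m}) > 0" using True m by simp
    then have B': "B - {m} \<noteq> {}" by (metis card.empty less_irrefl)
    have m': "m' \<in> B - {m}" unfolding m'_def by (rule Max_in) (use B' insert in auto)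
    have le_m: "b \<le> m" if "b \<in> B" for b using that insert by (auto simp: m_def)
    have le_m': "b \<le> m'" if "b \<in> B" "b \<noteq> m" for b using that insert by (auto simp: m'_def)
    \<comment> \<open>Of two distinct summands at most one is \<open>m\<close>; the other is at most
      \<open>m'\<close>.\<close>
    have bound: "s \<le> m + m'" if "s \<in> restricted_sumset B" for s
    proof -
      from that obtain a b where ab: "a \<in> B" "b \<in> B" "a \<noteq> b" "s = a + b"
        by (auto simp: restricted_sumset_def)
      show ?thesis
      proof (cases "b = m")
        case True
        then show ?thesis using ab le_m'[of a] by (simp add: add.commute add_left_mono)
      next
        case False
        then show ?thesis using ab le_m[of a] le_m'[of b] by (simp add: add_mono)
      qed
    qed
    have lt: "m < x" "m' < m" using insert m m' le_m[of m'] by auto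
    then have new: "m + m' < x + m'" "m + m' < x + m"
      by (auto simp: add_strict_mono order.strict_trans)
    then have "x + m \<notin> restricted_sumset B" "x + m' \<notin> restricted_sumset B"
      using bound by (blast dest: leD)+
    then have "card (restricted_sumset B) + 2 = card (restricted_sumset B \<union> {x + m, x + m'})"
      using m' finite_restricted_sumset[OF insert(1)]
      by (subst card_Un_disjoint) auto
    also have "\<dots> \<le> card (restricted_sumset (insert x B))"
      by (rule card_mono) (use insert m m' x in \<open>auto simp: finite_restricted_sumset restricted_sumset_insert\<close>)
    finally show ?thesis using insert.IH[OF True] insert x by simp
  qed
qed

text \<open>Distinctness removes exactly the extreme sums 0 + 0 and n + n. Every other
  \<open>s\<close> comes from the pair 0, \<open>s\<close> or the pair \<open>n\<close>,
  \<open>s - n\<close>.\<close>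

lemma restricted_sumset_atLeastAtMost:
  fixes n :: int
  assumes "n \<ge> 1"
  shows "restricted_sumset {0..n} = {1..2 * n - 1}"
proof (intro subset_antisym subsetI)
  fix s assume "s \<in> {1..2 * n - 1}"
  then have *: "0 < s" "s < 2 * n" by auto
  show "s \<in> restricted_sumset {0..n}"
  proof (cases "s \<le> n")
    case True
    then show ?thesis using * unfolding restricted_sumset_def
      by (intro CollectI exI[of _ 0] exI[of _ s]) auto
  next
    case False
    then show ?thesis using * unfolding restricted_sumset_def
      by (intro CollectI exI[of _ n] exI[of _ "s - n"]) auto
  qed
qed (auto simp: restricted_sumset_def)

lemma ex_restricted_sumset_card:
  assumes "k \<ge> 2" "2 * k \<le> t + 3" "2 * t + k \<le> k ^ 2"
  shows "\<exists>A :: int set. A \<subseteq> {0..2 ^ (k - 2)} \<and> card A = k \<and> card (restricted_sumset A) = t"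
  using assms
proof (induction k arbitrary: t rule: dec_induct)
  case base
  have "t = 1" using base by simp
  moreover have "restricted_sumset {0, 1 :: int} = {1}"
    by (subst restricted_sumset_insert) auto
  ultimately show ?case
    by (intro exI[of _ "{0, 1}"]) simp
next
  case (step k)
  have "k - 1 = Suc (k - 2)" using step(1) by simp
  then have pow: "(2 :: int) ^ (k - 1) = 2 * 2 ^ (k - 2)" by simp
  show ?case
  \<comment> \<open>Beyond this threshold \<open>t - k\<close> meets the lower bound required for
    \<open>k\<close> elements, so the induction hypothesis applies; up to it, an explicit set is
    given.\<close>
  proof (cases "t + 3 \<le> 3 * k")
    case True
    \<comment> \<open>Needed to fit the extra point, which is at most 2 (k - 1), below
      \<open>2 ^ (k - 1)\<close>.\<close>
    have "2 * int m \<le> 2 ^ m" for m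
    proof (induction m)
      case (Suc m)
      have "(2 :: int) \<le> 2 ^ Suc m" by simp
      then show ?case using Suc by (cases m) auto
    qed simp
    from this[of "k - 1"] have small: "2 * int k - 2 \<le> 2 ^ (k - 1)"
      using step(1) by (simp add: algebra_simps)
    define n where "n = int k - 1"
    \<comment> \<open>Chosen so that the largest sum \<open>x + n\<close> is \<open>t\<close>. As
      \<open>x \<le> 2 * n\<close>, the translate starts no later than just after
      \<open>2 * n - 1\<close>, and the sums fill \<open>{1..int t}\<close> without a gap.\<close>
    define x where "x = int t - n"
    have n: "n \<ge> 1" using step(1) by (simp add: n_def)
    have x: "n < x" "x \<le> 2 * n" using True step(4) by (simp_all add: n_def x_def)
    have "restricted_sumset (insert x {0..n}) = {1..2 * n - 1} \<union> {x..x + n}"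
      using x n by (subst restricted_sumset_insert) (auto simp: restricted_sumset_atLeastAtMost)
    also have "\<dots> = {1..int t}" using x n by (auto simp: x_def)
    finally have "card (restricted_sumset (insert x {0..n})) = t" by simp
    moreover have "card (insert x {0..n}) = Suc k" using x by (simp add: n_def)
    moreover have "insert x {0..n} \<subseteq> {0..2 ^ (Suc k - 2)}" using x n small by (auto simp: n_def)
    ultimately show ?thesis by blast
  next
    case False
    have "2 * (t - k) + k \<le> k ^ 2" using step(5) False by (simp add: power2_eq_square)
    moreover have "2 * k \<le> (t - k) + 3" using False by simp
    ultimately obtain A :: "int set"
      where A: "A \<subseteq> {0..2 ^ (k - 2)}" "card A = k" "card (restricted_sumset A) = t - k"
      using step.IH by blast
    have fin: "finite A" using A(1) finite_subset by blast
    define x :: int where "x = 2 ^ (k - 1)"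
    have "(2::int) ^ (k - 2) < x" unfolding x_def pow by simp
    then have x: "x \<notin> A" using A(1) by auto
    \<comment> \<open>Equality would force both summands to be \<open>2 ^ (k - 2)\<close>, against
      distinctness. Strictness matters: if 0 is in \<open>A\<close>, then \<open>x\<close> itself is
      a new sum.\<close>
    have "s < x" if "s \<in> restricted_sumset A" for s
    proof -
      from that obtain a b where "a \<in> A" "b \<in> A" "a \<noteq> b" "s = a + b"
        by (auto simp: restricted_sumset_def)
      moreover from this have "a \<le> 2 ^ (k - 2)" "b \<le> 2 ^ (k - 2)" using A(1) by auto
      ultimately show ?thesis unfolding x_def pow by linarith
    qed
    moreover have "x \<le> s" if "s \<in> (+) x ` A" for s using that A(1) by auto
    ultimately have "restricted_sumset A \<inter> (+) x ` A = {}" by (meson disjoint_iff leD)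
    then have "card (restricted_sumset (insert x A)) = (t - k) + k"
      using x fin A by (simp add: restricted_sumset_insert card_Un_disjoint finite_restricted_sumset card_image)
    moreover have "card (insert x A) = Suc k" using A x fin by simp
    moreover have "A \<subseteq> {0..x}"
      using A(1) less_imp_le[OF \<open>2 ^ (k - 2) < x\<close>] by (auto intro: order.trans)
    then have "insert x A \<subseteq> {0..2 ^ (Suc k - 2)}" by (simp add: x_def)
    ultimately show ?thesis using False by (intro exI[of _ "insert x A"]) auto
  qed
qed

text \<open>Multiples of a positive element increase strictly, hence never repeat. Nonnegative
  arguments suffice, because the integer examples and their sums lie there.\<close>

lemma ex_add_inj_on_nonneg:
  assumes "\<exists>x :: 'a::linordered_ab_group_add. x \<noteq> 0"
  shows "\<exists>f :: int \<Rightarrow> 'a. inj_on f {0..} \<and> (\<forall>a\<ge>0. \<forall>b\<ge>0. f (a + b) = f a + f b)"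
proof -
  obtain x :: 'a where x: "x > 0"
    using assms by (metis neg_0_less_iff_less neqE)
  \<comment> \<open>\<open>g n\<close> is the \<open>n\<close>-fold multiple of \<open>x\<close>.
    Since \<open>nat\<close> sends negative integers to 0, the map \<open>g (nat a)\<close> is
    additive and injective only on \<open>{0..}\<close>.\<close>
  define g where "g n = (\<Sum>i<n. x)" for n :: nat
  have add: "g (m + n) = g m + g n" for m n
    by (induction n) (auto simp: g_def add.assoc)
  have "strict_mono g"
    using x by (simp add: strict_mono_Suc_iff g_def)
  then have inj: "inj g" by (rule strict_mono_imp_inj_on)
  have "inj_on (\<lambda>a. g (nat a)) {0..}"
    by (auto simp: inj_on_def dest: injD[OF inj])
  then show ?thesis
    by (intro exI[of _ "\<lambda>a. g (nat a)"]) (auto simp: add nat_add_distrib)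
qed

text \<open>Injectivity keeps distinct summands distinct under \<open>f\<close>, which gives the
  inclusion from right to left.\<close>

lemma restricted_sumset_image:
  assumes "inj_on f A" "\<And>a b. a \<in> A \<Longrightarrow> b \<in> A \<Longrightarrow> f (a + b) = f a + f b"
  shows "restricted_sumset (f ` A) = f ` restricted_sumset A"
proof (intro subset_antisym subsetI)
  fix s assume "s \<in> restricted_sumset (f ` A)"
  then obtain a b where ab: "a \<in> A" "b \<in> A" "f a \<noteq> f b" "s = f a + f b"
    by (auto simp: restricted_sumset_def)
  then have "s = f (a + b)" "a + b \<in> restricted_sumset A"
    using assms(2) by (auto simp: restricted_sumset_def)
  then show "s \<in> f ` restricted_sumset A" by blast
next
  fix s assume "s \<in> f ` restricted_sumset A"
  then obtain a b where ab: "a \<in> A" "b \<in> A" "a \<noteq> b" "s = f (a + b)"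
    by (auto simp: restricted_sumset_def)
  then have "s = f a + f b" "f a \<noteq> f b"
    using assms by (auto dest: inj_onD)
  then show "s \<in> restricted_sumset (f ` A)"
    using ab unfolding restricted_sumset_def by blast
qed

lemma int_interval_eq:
  assumes "k \<ge> 2"
  shows "int_interval (2 * real k - 3) ((real k ^ 2 - real k) / 2)
       = int ` {t. 2 * k \<le> t + 3 \<and> 2 * t + k \<le> k ^ 2}"
proof -
  have *: "2 * real k - 3 \<le> real_of_int (int t) \<longleftrightarrow> 2 * k \<le> t + 3"
    "real_of_int (int t) \<le> (real k ^ 2 - real k) / 2 \<longleftrightarrow> 2 * t + k \<le> k ^ 2" for t
  proof -
    have "2 * k \<le> t + 3 \<longleftrightarrow> real (2 * k) \<le> real (t + 3)" by (rule of_nat_le_iff[symmetric])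
    then show "2 * real k - 3 \<le> real_of_int (int t) \<longleftrightarrow> 2 * k \<le> t + 3" by auto
    have "2 * t + k \<le> k ^ 2 \<longleftrightarrow> real (2 * t + k) \<le> real (k ^ 2)" by (rule of_nat_le_iff[symmetric])
    then show "real_of_int (int t) \<le> (real k ^ 2 - real k) / 2 \<longleftrightarrow> 2 * t + k \<le> k ^ 2"
      by (auto simp: field_simps)
  qed
  \<comment> \<open>The lower endpoint is at least 1 for \<open>k \<ge> 2\<close>, so each integer
    in the interval is the image of a natural number.\<close>
  have "c \<ge> 0" if "2 * real k - 3 \<le> real_of_int c" for c using that assms by linarith
  then show ?thesis
    unfolding int_interval_def using *
    by (auto simp del: of_int_of_nat_eq simp: image_iff) (metis int_nat_eq nat_0_le)+
qed

lemma restricted_sumset_sizes_eq: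
  assumes "\<exists>x :: 'a::linordered_ab_group_add. x \<noteq> 0" "k \<ge> 2"
  shows "restricted_sumset_sizes (UNIV :: 'a set) k
       = int_interval (2 * real k - 3) ((real k ^ 2 - real k) / 2)"
  unfolding int_interval_eq[OF assms(2)]
proof (intro subset_antisym subsetI)
  fix s assume "s \<in> restricted_sumset_sizes (UNIV :: 'a set) k"
  then obtain A :: "'a set" where "finite A" "card A = k" "s = int (card (restricted_sumset A))"
    by (auto simp: restricted_sumset_sizes_def)
  then show "s \<in> int ` {t. 2 * k \<le> t + 3 \<and> 2 * t + k \<le> k ^ 2}"
    using card_restricted_sumset_le[of A] card_restricted_sumset_ge[of A] assms(2) by auto
next
  fix s assume "s \<in> int ` {t. 2 * k \<le> t + 3 \<and> 2 * t + k \<le> k ^ 2}"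
  then obtain t where t: "s = int t" "2 * k \<le> t + 3" "2 * t + k \<le> k ^ 2" by auto
  obtain A :: "int set"
    where A: "A \<subseteq> {0..2 ^ (k - 2)}" "card A = k" "card (restricted_sumset A) = t"
    using ex_restricted_sumset_card[OF assms(2) t(2,3)] by blast
  obtain f :: "int \<Rightarrow> 'a"
    where f: "inj_on f {0..}" "\<And>a b. a \<ge> 0 \<Longrightarrow> b \<ge> 0 \<Longrightarrow> f (a + b) = f a + f b"
    using ex_add_inj_on_nonneg[OF assms(1)] by blast
  have fin: "finite A" using A(1) finite_subset by blast
  have "A \<subseteq> {0..}" using A(1) by auto
  moreover from this have "restricted_sumset A \<subseteq> {0..}"
    by (auto simp: restricted_sumset_def subset_iff)
  ultimately have nonneg: "A \<subseteq> {0..}" "restricted_sumset A \<subseteq> {0..}" by blast+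
  \<comment> \<open>Injectivity on \<open>A\<close> preserves the number of elements, and on its
    restricted sumset the number of sums.\<close>
  note inj = nonneg[THEN inj_on_subset[OF f(1)]]
  have "restricted_sumset (f ` A) = f ` restricted_sumset A"
    using nonneg by (intro restricted_sumset_image inj f(2)) auto
  then have "card (restricted_sumset (f ` A)) = t" "card (f ` A) = k"
    using A inj by (simp_all add: card_image)
  then show "s \<in> restricted_sumset_sizes (UNIV :: 'a set) k"
    unfolding restricted_sumset_sizes_def t(1) using fin
    by (intro CollectI exI[of _ "f ` A"]) simp
qed

theorem theorem6:
  fixes k :: nat
  assumes nontrivial: "\<exists>x :: 'a::linordered_ab_group_add. x \<noteq> 0"
    and "k \<ge> 2"
  shows "restricted_sumset_sizes (UNIV :: int set) k = restricted_sumset_sizes (UNIV :: 'a set) k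
       \<and> restricted_sumset_sizes (UNIV :: 'a set) k
           = int_interval (2 * real k - 3) ((real k ^ 2 - real k) / 2)
       \<and> (\<forall>t \<in> restricted_sumset_sizes (UNIV :: int set) k.
            \<exists>A :: int set. A \<subseteq> int_interval 0 (2 ^ (k - 2)) \<and> finite A \<and> card A = k
              \<and> int (card (restricted_sumset A)) = t)"
proof (intro conjI ballI)
  have sizes_int: "restricted_sumset_sizes (UNIV :: int set) k
      = int_interval (2 * real k - 3) ((real k ^ 2 - real k) / 2)"
    by (rule restricted_sumset_sizes_eq[OF _ assms(2)]) (rule exI[of _ 1], simp)
  show sizes: "restricted_sumset_sizes (UNIV :: 'a set) k
      = int_interval (2 * real k - 3) ((real k ^ 2 - real k) / 2)"
    by (rule restricted_sumset_sizes_eq[OF assms])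
  show "restricted_sumset_sizes (UNIV :: int set) k = restricted_sumset_sizes (UNIV :: 'a set) k"
    unfolding sizes sizes_int ..
  fix s assume "s \<in> restricted_sumset_sizes (UNIV :: int set) k"
  then obtain t where t: "s = int t" "2 * k \<le> t + 3" "2 * t + k \<le> k ^ 2"
    unfolding sizes_int int_interval_eq[OF assms(2)] by auto
  \<comment> \<open>A set witnessing \<open>s\<close> may lie anywhere in the integers; only the
    bounds on \<open>t\<close> are kept, and the construction supplies a set in the required
    range.\<close>
  obtain A :: "int set"
    where A: "A \<subseteq> {0..2 ^ (k - 2)}" "card A = k" "card (restricted_sumset A) = t"
    using ex_restricted_sumset_card[OF assms(2) t(2,3)] by blast
  have "finite A" using A(1) finite_subset by blast
  moreover have "real_of_int c \<le> 2 ^ (k - 2)" if "c \<le> 2 ^ (k - 2)" for c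
    using that by (metis of_int_le_iff of_int_numeral of_int_power)
  then have "A \<subseteq> int_interval 0 (2 ^ (k - 2))"
    using A(1) by (auto simp: int_interval_def)
  ultimately show "\<exists>A :: int set. A \<subseteq> int_interval 0 (2 ^ (k - 2)) \<and> finite A \<and> card A = k
      \<and> int (card (restricted_sumset A)) = s"
    using A(2,3) t(1) by blast
qed

end
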